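(* Let $X,Y\subseteq\mathbb{N}$, let $n\ge1$ and $s\ge0$ be integers. Then $$P_{n,s}^{X,Y}=|X_n^c|!\sum_{r=0}^{|X_n|-s}(-1)^{|X_n|-s-r}\binom{|X_n^c|+r}{r}\binom{n+1}{|X_n|-s-r}\prod_{x\in X_n}\bigl(r+\beta_{X,n,x}-\beta_{Y,n,x}\bigr).$$
   Context: $\mathbb{N}=\{1,2,\dots\}$, $S_n$ is the set of permutations $\sigma=\sigma_1\cdots\sigma_n$ of $[n]=\{1,\dots,n\}$. For $X,Y\subseteq\mathbb{N}$, an $X,Y$-descent of $\sigma$ is an index $i$ with $\sigma_i>\sigma_{i+1}$, $\sigma_i\in X$, $\sigma_{i+1}\in Y$; $des_{X,Y}(\sigma)$ is the number of such $i$, and $P_{n,s}^{X,Y}$ is the number of $\sigma\in S_n$ with $des_{X,Y}(\sigma)=s$. For $S\subseteq\mathbb{N}$: $S_n=S\cap[n]$, $S_n^c=[n]\setminus S$, and for $1\le j\le n$, $\beta_{S,n,j}=|\{z:1\le z<j,\ z\notin S\}|$. An empty sum is $0$. *)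

theory Defs
  imports "HOL-Combinatorics.Permutations"
begin

text \<open>A permutation \<open>\<sigma>\<^sub>1 \<cdots> \<sigma>\<^sub>n\<close> of \<open>{1..n}\<close> is a function \<open>\<sigma>\<close> with \<open>\<sigma> permutes {1..n}\<close>.
  As such a function is the identity outside \<open>{1..n}\<close>, the positions of descents have to be
  bounded explicitly by \<open>1 \<le> i < n\<close>.\<close>

definition des :: "nat set \<Rightarrow> nat set \<Rightarrow> nat \<Rightarrow> (nat \<Rightarrow> nat) \<Rightarrow> nat" where
  "des X Y n \<sigma> = card {i. 1 \<le> i \<and> i < n \<and> \<sigma> i > \<sigma> (Suc i) \<and> \<sigma> i \<in> X \<and> \<sigma> (Suc i) \<in> Y}"

definition perm_count :: "nat set \<Rightarrow> nat set \<Rightarrow> nat \<Rightarrow> nat \<Rightarrow> nat" where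
  "perm_count X Y n s = card {\<sigma>. \<sigma> permutes {1..n} \<and> des X Y n \<sigma> = s}"

definition restr :: "nat set \<Rightarrow> nat \<Rightarrow> nat set" where
  "restr S n = S \<inter> {1..n}"

definition restr_compl :: "nat set \<Rightarrow> nat \<Rightarrow> nat set" where
  "restr_compl S n = {1..n} - S"

text \<open>This is \<open>\<beta>\<^bsub>S,n,j\<^esub>\<close>; for \<open>j \<le> n\<close> it does not depend on \<open>n\<close>.\<close>

definition beta :: "nat set \<Rightarrow> nat \<Rightarrow> nat" where
  "beta S j = card {z. 1 \<le> z \<and> z < j \<and> z \<notin> S}"

end

theory Submission
  imports Defs "HOL-Combinatorics.Multiset_Permutations"
begin

text \<open>Inserting \<open>n + 1\<close> at all \<open>n + 1\<close> positions of each permutation of \<open>{1..n}\<close> yields all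
  permutations of \<open>{1..n + 1}\<close>, and how an insertion affects the number of descents depends only on
  whether the position is a descent, whether \<open>n + 1 \<in> X\<close>, and whether the next letter is in \<open>Y\<close>.
  Counting by the defect \<open>t = |X\<^sub>n| - des\<close>, the numbers \<open>F\<^sub>n(t)\<close> therefore satisfy
  \<open>F\<^sub>n\<^sub>+\<^sub>1(t) = (t + c) F\<^sub>n(t) + (n + 2 - t - c) F\<^sub>n(t - 1)\<close> with
  \<open>c = \<beta>\<^sub>X(n + 1) - \<beta>\<^sub>Y(n + 1)\<close> if \<open>n + 1 \<in> X\<close> and \<open>c = |X\<^sub>n\<^sup>c| + 1\<close> otherwise.
  The alternating sums \<open>\<Sum>\<^sub>r (-1)\<^bsup>t - r\<^esup> (n + 1 choose t - r) a\<^sub>n(r)\<close> obey the same recurrence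
  if \<open>a\<^sub>n\<^sub>+\<^sub>1(r) = (r + c) a\<^sub>n(r)\<close>, which holds for
  \<open>a\<^sub>n(r) = |X\<^sub>n\<^sup>c|! (|X\<^sub>n\<^sup>c| + r choose r) \<Prod>\<^sub>x (r + \<beta>\<^sub>X(x) - \<beta>\<^sub>Y(x))\<close>.\<close>

section \<open>Alternating binomial sums\<close>

text \<open>This is the coefficient of \<open>x^t\<close> in \<open>(1 - x)^(n + 1)\<close> times
  the generating function of \<open>a\<close>.\<close>

definition alt_sum :: "nat \<Rightarrow> (nat \<Rightarrow> int) \<Rightarrow> nat \<Rightarrow> int" where
  "alt_sum n a t = (\<Sum>r\<le>t. (-1) ^ (t - r) * int (Suc n choose (t - r)) * a r)"

lemma alt_sum_0: "alt_sum n a 0 = a 0"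
  by (simp add: alt_sum_def)

text \<open>The coefficients of each \<open>a r\<close> agree: for \<open>r = Suc t\<close> both are
  \<open>int (Suc t) + c\<close>, and for \<open>r \<le> t\<close> Pascal's rule and absorption
  reduce them to one identity between neighbouring binomials.\<close>

lemma alt_sum_Suc_mult:
  "alt_sum (Suc n) (\<lambda>r. (int r + c) * a r) (Suc t) =
    (int (Suc t) + c) * alt_sum n a (Suc t) + (int n + 1 - int t - c) * alt_sum n a t"
proof -
  have coeff: "(-1) ^ (Suc t - r) * int (Suc (Suc n) choose (Suc t - r)) * ((int r + c) * a r) =
      (int (Suc t) + c) * ((-1) ^ (Suc t - r) * int (Suc n choose (Suc t - r)) * a r)
      + (int n + 1 - int t - c) * ((-1) ^ (t - r) * int (Suc n choose (t - r)) * a r)"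
    if "r \<le> t" for r
  proof -
    define j where "j = t - r"
    have t: "t = r + j" using that by (simp add: j_def)
    have "int (Suc (Suc n) * (Suc n choose j)) = int ((Suc (Suc n) choose Suc j) * Suc j)"
      by (simp only: Suc_times_binomial_eq)
    then have absorb: "int (Suc j) * int (Suc n choose Suc j) = (int n + 1 - int j) * int (Suc n choose j)"
      by (simp add: algebra_simps del: binomial_Suc_Suc) (simp add: algebra_simps)
    define p where "p = int (Suc n choose Suc j)"
    define q where "q = int (Suc n choose j)"
    have pq: "(int j + 1) * p = (int n + 1 - int j) * q"
      using absorb by (simp add: p_def q_def algebra_simps)
    have "int (Suc (Suc n) choose Suc j) = q + p"
      by (simp add: p_def q_def)
    \<comment> \<open>The two sides differ exactly by the difference of the two sides of
      \<open>pq\<close>.\<close>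
    moreover have "(q + p) * (int r + c) = (int r + int j + 1 + c) * p - (int n + 1 - int r - int j - c) * q"
      using pq by (simp add: algebra_simps)
    ultimately have "- int (Suc (Suc n) choose Suc j) * (int r + c) =
        - (int r + int j + 1 + c) * p + (int n + 1 - int r - int j - c) * q"
      by (simp add: algebra_simps)
    then have "(-1) ^ j * a r * (- int (Suc (Suc n) choose Suc j) * (int r + c)) =
        (-1) ^ j * a r * (- (int r + int j + 1 + c) * p + (int n + 1 - int r - int j - c) * q)"
      by (rule arg_cong)
    moreover have "Suc t - r = Suc j" "t - r = j" by (simp_all add: t)
    ultimately show ?thesis
      unfolding p_def q_def by (simp add: t algebra_simps del: binomial_Suc_Suc)
  qed
  show ?thesis
    unfolding alt_sum_def
    by (simp add: coeff sum.distrib sum_distrib_left distrib_left del: binomial_Suc_Suc of_nat_Suc power_Suc)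
qed

section \<open>Descents of words and insertion of a largest letter\<close>

primrec list_des :: "nat set \<Rightarrow> nat set \<Rightarrow> nat list \<Rightarrow> nat" where
  "list_des X Y [] = 0"
| "list_des X Y (x # xs) =
    of_bool (xs \<noteq> [] \<and> x > hd xs \<and> x \<in> X \<and> hd xs \<in> Y) + list_des X Y xs"

text \<open>Positions count from 0 and mark the larger letter, so the gap inside the descent at
  \<open>i\<close> is gap \<open>Suc i\<close>.\<close>

definition desc_pos :: "nat set \<Rightarrow> nat set \<Rightarrow> nat list \<Rightarrow> nat set" where
  "desc_pos X Y xs =
    {i. Suc i < length xs \<and> xs ! i > xs ! Suc i \<and> xs ! i \<in> X \<and> xs ! Suc i \<in> Y}"

lemma finite_desc_pos [simp]: "finite (desc_pos X Y xs)"
  by (rule finite_subset[of _ "{..<length xs}"]) (auto simp: desc_pos_def)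

lemma list_des_eq_card: "list_des X Y xs = card (desc_pos X Y xs)"
proof (induction xs)
  case Nil
  then show ?case by (simp add: desc_pos_def)
next
  case (Cons x xs)
  have "desc_pos X Y (x # xs) =
      (if xs \<noteq> [] \<and> x > hd xs \<and> x \<in> X \<and> hd xs \<in> Y then {0} else {}) \<union> Suc ` desc_pos X Y xs"
    (is "?A = ?B")
  proof (rule set_eqI)
    fix i show "i \<in> ?A \<longleftrightarrow> i \<in> ?B"
      by (cases i; cases xs) (auto simp: desc_pos_def)
  qed
  then show ?case
    using Cons by (simp add: card_image)
qed

lemma list_des_append:
  "list_des X Y (xs @ ys) = list_des X Y xs + list_des X Y ys
    + of_bool (xs \<noteq> [] \<and> ys \<noteq> [] \<and> last xs > hd ys \<and> last xs \<in> X \<and> hd ys \<in> Y)"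
  by (induction xs) (auto simp: hd_append)

text \<open>Each descent is charged to its larger letter, which lies in \<open>X\<close>;
  distinctness makes the charging injective.\<close>

lemma list_des_le:
  assumes "distinct xs"
  shows "list_des X Y xs \<le> card (X \<inter> set xs)"
  unfolding list_des_eq_card
  by (rule card_inj_on_le[of "(!) xs"])
     (use assms in \<open>auto simp: desc_pos_def inj_on_def nth_eq_iff_index_eq\<close>)

definition insert_at :: "'a \<Rightarrow> nat \<Rightarrow> 'a list \<Rightarrow> 'a list" where
  "insert_at x i xs = take i xs @ x # drop i xs"

text \<open>A letter above all others is never the smaller letter of a descent. Hence inserting it
  can only destroy a descent across gap \<open>i\<close> and create one with the letter that
  follows. The additive form avoids truncated subtraction.\<close>

lemma list_des_insert_at:
  assumes "\<And>x. x \<in> set xs \<Longrightarrow> x < N" and "i \<le> length xs"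
  shows "list_des X Y (insert_at N i xs) + of_bool (i \<in> Suc ` desc_pos X Y xs) =
    list_des X Y xs + of_bool (N \<in> X \<and> i < length xs \<and> xs ! i \<in> Y)"
proof -
  have "list_des X Y (insert_at N i xs) = list_des X Y (take i xs) + list_des X Y (N # drop i xs)"
  proof -
    have "\<not> last (take i xs) > N" if "take i xs \<noteq> []"
      using assms(1)[of "last (take i xs)"] last_in_set[OF that] by (auto dest: in_set_takeD)
    then show ?thesis
      unfolding insert_at_def list_des_append by auto
  qed
  moreover have "list_des X Y (N # drop i xs) =
      of_bool (N \<in> X \<and> i < length xs \<and> xs ! i \<in> Y) + list_des X Y (drop i xs)"
    using assms by (auto simp: hd_drop_conv_nth)
  \<comment> \<open>Cutting the original word at the same gap isolates the descent that the
    insertion breaks.\<close>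
  moreover have "list_des X Y (take i xs @ drop i xs) = list_des X Y (take i xs)
      + list_des X Y (drop i xs) + of_bool (i \<in> Suc ` desc_pos X Y xs)"
  proof (cases i)
    case 0
    then show ?thesis by simp
  next
    case (Suc k)
    then have "last (take i xs) = xs ! k"
      using assms(2) by (simp add: take_Suc_conv_app_nth)
    then show ?thesis
      unfolding list_des_append using Suc assms(2)
      by (auto simp: desc_pos_def hd_drop_conv_nth image_iff)
  qed
  ultimately show ?thesis by simp
qed

text \<open>The inverse cuts a word at its only occurrence of \<open>N\<close>.\<close>

lemma bij_betw_insert_at:
  assumes "finite A" and "N \<notin> A"
  shows "bij_betw (\<lambda>(xs, i). insert_at N i xs)
    (permutations_of_set A \<times> {..card A}) (permutations_of_set (insert N A))"
proof (rule bij_betw_imageI)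
  have take: "takeWhile (\<lambda>x. x \<noteq> N) (insert_at N i xs) = take i xs"
    and drop: "tl (dropWhile (\<lambda>x. x \<noteq> N) (insert_at N i xs)) = drop i xs"
    if "xs \<in> permutations_of_set A" for xs i
  proof -
    have "\<And>x. x \<in> set (take i xs) \<Longrightarrow> x \<noteq> N"
      using that assms(2) by (auto dest!: in_set_takeD permutations_of_setD(1))
    then show "takeWhile (\<lambda>x. x \<noteq> N) (insert_at N i xs) = take i xs"
      "tl (dropWhile (\<lambda>x. x \<noteq> N) (insert_at N i xs)) = drop i xs"
      by (simp_all add: insert_at_def)
  qed
  show "inj_on (\<lambda>(xs, i). insert_at N i xs) (permutations_of_set A \<times> {..card A})"
  proof -
    have "xs = ys \<and> i = j"
      if xs: "xs \<in> permutations_of_set A" "i \<in> {..card A}"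
        and ys: "ys \<in> permutations_of_set A" "j \<in> {..card A}"
        and eq: "insert_at N i xs = insert_at N j ys" for xs i ys j
    proof -
      have "take i xs = take j ys" "drop i xs = drop j ys"
        using take drop xs ys eq by metis+
      moreover have "length xs = card A" "length ys = card A"
        using xs ys by (auto dest: length_finite_permutations_of_set)
      \<comment> \<open>The gap is the length of the prefix. The bound \<open>card A\<close>
        matters, since \<open>take\<close> ignores any excess.\<close>
      ultimately show ?thesis
        using xs(2) ys(2) by (metis append_take_drop_id atMost_iff length_take min.absorb2)
    qed
    then show ?thesis
      by (auto simp: inj_on_def)
  qed
  show "(\<lambda>(xs, i). insert_at N i xs) ` (permutations_of_set A \<times> {..card A}) =
    permutations_of_set (insert N A)"
  proof (intro equalityI subsetI)
    fix zs assume "zs \<in> (\<lambda>(xs, i). insert_at N i xs) ` (permutations_of_set A \<times> {..card A})"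
    then obtain xs i where xs: "xs \<in> permutations_of_set A" and zs: "zs = insert_at N i xs"
      by auto
    have "set (take i xs) \<union> set (drop i xs) = set xs"
      by (metis append_take_drop_id set_append)
    then show "zs \<in> permutations_of_set (insert N A)"
      using permutations_of_setD[OF xs] assms(2) zs
      by (auto simp: insert_at_def permutations_of_set_def set_take_disj_set_drop_if_distinct)
  next
    fix zs assume "zs \<in> permutations_of_set (insert N A)"
    then have zs: "set zs = insert N A" "distinct zs"
      by (auto dest: permutations_of_setD)
    then obtain us vs where uv: "zs = us @ N # vs"
      by (metis insertI1 split_list)
    have "us @ vs \<in> permutations_of_set A"
      using zs assms(2) unfolding uv permutations_of_set_def by auto
    moreover from this have "length us \<le> card A"
      using length_finite_permutations_of_set by fastforce
    ultimately show "zs \<in> (\<lambda>(xs, i). insert_at N i xs) ` (permutations_of_set A \<times> {..card A})"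
      by (intro image_eqI[of _ _ "(us @ vs, length us)"]) (auto simp: uv insert_at_def)
  qed
qed

section \<open>Permutations as words\<close>

lemma bij_betw_permutes_lists:
  "bij_betw (\<lambda>\<sigma>. map \<sigma> [1..<Suc n]) {\<sigma>. \<sigma> permutes {1..n}} (permutations_of_set {1..n})"
proof (rule bij_betw_imageI)
  show inj: "inj_on (\<lambda>\<sigma>. map \<sigma> [1..<Suc n]) {\<sigma>. \<sigma> permutes {1..n}}"
  proof (rule inj_onI, rule ext)
    fix \<sigma> \<tau> x
    assume perm: "\<sigma> \<in> {\<sigma>. \<sigma> permutes {1..n}}" "\<tau> \<in> {\<sigma>. \<sigma> permutes {1..n}}"
      and eq: "map \<sigma> [1..<Suc n] = map \<tau> [1..<Suc n]"
    show "\<sigma> x = \<tau> x"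
    proof (cases "x \<in> {1..n}")
      case True
      then show ?thesis using eq by (auto simp del: upt_Suc)
    next
      case False
      then show ?thesis using perm by (metis mem_Collect_eq permutes_not_in)
    qed
  qed
  have sub: "(\<lambda>\<sigma>. map \<sigma> [1..<Suc n]) ` {\<sigma>. \<sigma> permutes {1..n}} \<subseteq> permutations_of_set {1..n}"
    using permutes_inj_on
    by (auto simp: permutations_of_set_def distinct_map permutes_image
        atLeastLessThanSuc_atLeastAtMost simp del: upt_Suc)
  \<comment> \<open>Surjectivity by counting: the image lies in a finite set of the same size
    \<open>fact n\<close>.\<close>
  have "card ((\<lambda>\<sigma>. map \<sigma> [1..<Suc n]) ` {\<sigma>. \<sigma> permutes {1..n}}) = fact n"
    unfolding card_image[OF inj] by (rule card_permutations) simp_all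
  then show "(\<lambda>\<sigma>. map \<sigma> [1..<Suc n]) ` {\<sigma>. \<sigma> permutes {1..n}} = permutations_of_set {1..n}"
    by (intro card_subset_eq[OF _ sub]) simp_all
qed

lemma des_eq_list_des: "des X Y n \<sigma> = list_des X Y (map \<sigma> [1..<Suc n])"
proof -
  \<comment> \<open>The shift by \<open>Suc\<close> passes from 0-based list indices to positions
    that start at 1.\<close>
  have "{i. 1 \<le> i \<and> i < n \<and> \<sigma> i > \<sigma> (Suc i) \<and> \<sigma> i \<in> X \<and> \<sigma> (Suc i) \<in> Y}
      = Suc ` desc_pos X Y (map \<sigma> [1..<Suc n])" (is "?A = ?B")
  proof (intro equalityI subsetI)
    fix i assume "i \<in> ?A"
    then show "i \<in> ?B"
      by (intro image_eqI[of _ _ "i - 1"]) (auto simp: desc_pos_def simp del: upt_Suc)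
  qed (auto simp: desc_pos_def simp del: upt_Suc)
  then show ?thesis
    by (simp add: des_def list_des_eq_card card_image del: upt_Suc)
qed

lemma perm_count_eq_list:
  "perm_count X Y n s = card {xs \<in> permutations_of_set {1..n}. list_des X Y xs = s}"
proof -
  define f :: "(nat \<Rightarrow> nat) \<Rightarrow> nat list" where "f = (\<lambda>\<sigma>. map \<sigma> [1..<Suc n])"
  have bij: "bij_betw f {\<sigma>. \<sigma> permutes {1..n}} (permutations_of_set {1..n})"
    unfolding f_def by (rule bij_betw_permutes_lists)
  have img: "f ` {\<sigma>. \<sigma> permutes {1..n} \<and> list_des X Y (f \<sigma>) = s}
      = {xs \<in> permutations_of_set {1..n}. list_des X Y xs = s}"
    unfolding bij_betw_imp_surj_on[OF bij, symmetric] by blast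
  have "inj_on f {\<sigma>. \<sigma> permutes {1..n} \<and> list_des X Y (f \<sigma>) = s}"
    using bij_betw_imp_inj_on[OF bij] by (rule inj_on_subset) blast
  from card_image[OF this] show ?thesis
    unfolding img by (simp add: perm_count_def des_eq_list_des f_def del: upt_Suc)
qed

section \<open>Recurrence for the defect counts\<close>

text \<open>With the sum in place of a truncated difference, the count is 0 as soon as
  \<open>t\<close> exceeds \<open>card (restr X n)\<close>.\<close>

definition defect_count :: "nat set \<Rightarrow> nat set \<Rightarrow> nat \<Rightarrow> nat \<Rightarrow> nat" where
  "defect_count X Y n t =
    card {xs \<in> permutations_of_set {1..n}. list_des X Y xs + t = card (restr X n)}"

lemma beta_Suc: "beta S (Suc n) = card (restr_compl S n)"
  by (auto simp: beta_def restr_compl_def intro!: arg_cong[of _ _ card])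

lemma card_restr_compl: "card (restr_compl S n) = n - card (restr S n)"
proof -
  have "restr_compl S n = {1..n} - restr S n"
    by (auto simp: restr_compl_def restr_def)
  then show ?thesis
    by (simp add: card_Diff_subset restr_def)
qed

lemma card_restr_le: "card (restr S n) \<le> n"
  using card_mono[of "{1..n}" "restr S n"] by (auto simp: restr_def)

lemma card_restr_Suc: "card (restr S (Suc n)) = card (restr S n) + of_bool (Suc n \<in> S)"
proof -
  have "restr S (Suc n) = restr S n \<union> (if Suc n \<in> S then {Suc n} else {})"
    by (auto simp: restr_def le_Suc_eq)
  then show ?thesis
    by (simp add: restr_def)
qed

text \<open>If \<open>Suc n \<in> X\<close>, the defect is kept at the gaps that precede a letter of
  \<open>Y\<close> without being descents, and grows by one at all others. If
  \<open>Suc n \<notin> X\<close>, it grows by one at the descents and is kept elsewhere. The two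
  summands count the insertions into words of defect \<open>t\<close> and
  \<open>t - 1\<close>.\<close>

lemma card_insertions:
  fixes X Y :: "nat set"
  assumes xs: "xs \<in> permutations_of_set {1..n}"
  defines "k \<equiv> card (restr X n)" and "d \<equiv> list_des X Y xs"
    and "c \<equiv> if Suc n \<in> X then int (beta X (Suc n)) - int (beta Y (Suc n))
      else int (card (restr_compl X n)) + 1"
  shows "int (card {i \<in> {..n}. list_des X Y (insert_at (Suc n) i xs) + t = card (restr X (Suc n))}) =
    (if d + t = k then int t + c else 0) + (if d + t = Suc k then int n + 2 - int t - c else 0)"
    (is "int (card ?I) = _")
proof -
  \<comment> \<open>\<open>D\<close> holds the gaps inside a descent, \<open>U\<close> the gaps
    followed by a letter of \<open>Y\<close>; the final gap \<open>n\<close> is in neither.\<close>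
  define D where "D = Suc ` desc_pos X Y xs"
  define U where "U = {i. i < n \<and> xs ! i \<in> Y}"
  have set_xs: "set xs = {1..n}" and dist: "distinct xs"
    using permutations_of_setD[OF xs] by auto
  then have len: "length xs = n"
    using distinct_card[of xs] by simp
  have fin: "finite D" "finite U" by (auto simp: D_def U_def)
  have card_D: "card D = d"
    by (simp add: D_def d_def list_des_eq_card card_image)
  have D_U: "D \<subseteq> U" and U_n: "U \<subseteq> {..n}"
    using len by (auto simp: D_def U_def desc_pos_def)
  have card_U: "card U = card (restr Y n)"
  proof -
    have "(!) xs ` U = Y \<inter> set xs"
      using len by (auto simp: U_def in_set_conv_nth)
    then have "(!) xs ` U = restr Y n"
      by (simp add: restr_def set_xs)
    moreover have "inj_on ((!) xs) U"
      using len dist by (auto simp: U_def inj_on_def nth_eq_iff_index_eq)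
    ultimately show ?thesis by (metis card_image)
  qed
  have "U \<subseteq> {..<n}" by (auto simp: U_def)
  then have U_le: "card U \<le> n" using card_mono[of "{..<n}" U] by simp
  have D_le: "d \<le> card U" using card_mono[OF fin(2) D_U] card_D by simp
  have k_le: "k \<le> n" by (simp add: k_def card_restr_le)
  have des: "list_des X Y (insert_at (Suc n) i xs) + of_bool (i \<in> D) = d + of_bool (Suc n \<in> X \<and> i \<in> U)"
    if "i \<le> n" for i
    using list_des_insert_at[of xs "Suc n" i X Y] that len set_xs by (auto simp: D_def d_def U_def)
  have card_Diff: "card (U - D) = card U - d" "card ({..n} - D) = Suc n - d"
      "card ({..n} - (U - D)) = Suc n - (card U - d)"
    using D_U U_n fin card_D by (simp_all add: card_Diff_subset subset_trans[OF Diff_subset])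
  show ?thesis
  proof (cases "Suc n \<in> X")
    case True
    \<comment> \<open>Thus \<open>c = card U - k\<close>, so \<open>card U - d\<close> equals
      \<open>t + c\<close> when \<open>d + t = k\<close>.\<close>
    have c: "c = int n - int k - (int n - int (card U))"
      using True k_le card_restr_le[of Y n] by (simp add: c_def beta_Suc card_restr_compl card_U k_def)
    have iff: "i \<in> ?I \<longleftrightarrow> i \<le> n \<and> d + of_bool (i \<in> U - D) + t = Suc k" for i
      using des[of i] True D_U by (cases "i \<in> D"; cases "i \<in> U") (auto simp: card_restr_Suc k_def)
    consider "d + t = k" | "d + t = Suc k" | "d + t \<noteq> k" "d + t \<noteq> Suc k" by blast
    then show ?thesis
    proof cases
      case 1
      then have "?I = U - D" using iff U_n by auto
      then show ?thesis using 1 D_le U_le by (simp add: c card_Diff)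
    next
      case 2
      then have "?I = {..n} - (U - D)" using iff by auto
      then show ?thesis using 2 D_le U_le by (simp add: c card_Diff)
    next
      case 3
      then have "i \<notin> ?I" for i unfolding iff by (auto simp: of_bool_def)
      then have "?I = {}" by blast
      then show ?thesis using 3 by (simp only: card.empty) simp
    qed
  next
    case False
    \<comment> \<open>Here \<open>n + 1 - d\<close> equals \<open>t + c\<close> when
      \<open>d + t = k\<close>, and \<open>d\<close> equals \<open>n + 2 - t - c\<close> when
      \<open>d + t = Suc k\<close>.\<close>
    have c: "c = int n - int k + 1"
      using False k_le by (simp add: c_def card_restr_compl k_def)
    have iff: "i \<in> ?I \<longleftrightarrow> i \<le> n \<and> d + t = k + of_bool (i \<in> D)" for i
      using des[of i] False by (cases "i \<in> D") (auto simp: card_restr_Suc k_def)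
    consider "d + t = k" | "d + t = Suc k" | "d + t \<noteq> k" "d + t \<noteq> Suc k" by blast
    then show ?thesis
    proof cases
      case 1
      then have "?I = {..n} - D" using iff by auto
      then show ?thesis using 1 D_le U_le by (simp add: c card_Diff)
    next
      case 2
      then have "?I = D" using iff D_U U_n by auto
      then show ?thesis using 2 by (simp add: c card_D)
    next
      case 3
      then have "i \<notin> ?I" for i unfolding iff by (auto simp: of_bool_def)
      then have "?I = {}" by blast
      then show ?thesis using 3 by (simp only: card.empty) simp
    qed
  qed
qed

text \<open>Every longer word arises from exactly one pair of a shorter word and a gap, so
  \<open>card_insertions\<close> is summed over the shorter words.\<close>

lemma defect_count_Suc:
  fixes X Y :: "nat set" and n :: nat
  defines "c \<equiv> if Suc n \<in> X then int (beta X (Suc n)) - int (beta Y (Suc n))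
      else int (card (restr_compl X n)) + 1"
  shows "int (defect_count X Y (Suc n) t) = (int t + c) * int (defect_count X Y n t)
    + (case t of 0 \<Rightarrow> 0 | Suc u \<Rightarrow> (int n + 1 - int u - c) * int (defect_count X Y n u))"
proof -
  let ?P = "permutations_of_set {1..n}"
  let ?k = "card (restr X n)"
  let ?good = "\<lambda>zs. list_des X Y zs + t = card (restr X (Suc n))"
  have ins: "insert (Suc n) {1..n} = {1..Suc n}" by auto
  define f where "f = (\<lambda>(xs, i). insert_at (Suc n) i xs)"
  have bij: "bij_betw f (?P \<times> {..n}) (permutations_of_set {1..Suc n})"
    using bij_betw_insert_at[of "{1..n}" "Suc n"] ins by (simp add: f_def)
  have img: "f ` {p \<in> ?P \<times> {..n}. ?good (f p)} = {zs \<in> permutations_of_set {1..Suc n}. ?good zs}"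
    unfolding bij_betw_imp_surj_on[OF bij, symmetric] by blast
  have inj: "inj_on f {p \<in> ?P \<times> {..n}. ?good (f p)}"
    using bij_betw_imp_inj_on[OF bij] by (rule inj_on_subset) blast
  have "defect_count X Y (Suc n) t = card {p \<in> ?P \<times> {..n}. ?good (f p)}"
    unfolding defect_count_def img[symmetric] by (rule card_image[OF inj])
  also have "{p \<in> ?P \<times> {..n}. ?good (f p)}
      = (SIGMA xs:?P. {i \<in> {..n}. ?good (insert_at (Suc n) i xs)})"
    by (auto simp: f_def)
  also have "card \<dots> = (\<Sum>xs\<in>?P. card {i \<in> {..n}. ?good (insert_at (Suc n) i xs)})"
    by simp
  finally have "int (defect_count X Y (Suc n) t) =
      (\<Sum>xs\<in>?P. (if list_des X Y xs + t = ?k then int t + c else 0)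
        + (if list_des X Y xs + t = Suc ?k then int n + 2 - int t - c else 0))"
    by (simp only: of_nat_sum card_insertions c_def cong: sum.cong)
  also have "\<dots> = (int t + c) * int (defect_count X Y n t)
      + (int n + 2 - int t - c) * int (card {xs \<in> ?P. list_des X Y xs + t = Suc ?k})"
    by (simp add: sum.distrib sum.If_cases Int_def defect_count_def mult.commute)
  \<comment> \<open>For \<open>t = 0\<close> the set is empty, as no word has more descents than
    letters in \<open>X\<close>; otherwise it consists of the words of defect
    \<open>t - 1\<close>.\<close>
  also have "(int n + 2 - int t - c) * int (card {xs \<in> ?P. list_des X Y xs + t = Suc ?k}) =
      (case t of 0 \<Rightarrow> 0 | Suc u \<Rightarrow> (int n + 1 - int u - c) * int (defect_count X Y n u))"
  proof (cases t)
    case 0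
    have "list_des X Y xs \<le> ?k" if "xs \<in> ?P" for xs
      using list_des_le[of xs X Y] permutations_of_setD[OF that] by (simp add: restr_def)
    then have "{xs \<in> ?P. list_des X Y xs + t = Suc ?k} = {}"
      using 0 by fastforce
    then show ?thesis by (simp only: card.empty) (simp add: 0)
  next
    case (Suc u)
    then show ?thesis by (simp add: defect_count_def)
  qed
  finally show ?thesis .
qed

section \<open>Solution of the recurrence\<close>

lemma defect_count_eq_alt_sum:
  "int (defect_count X Y n t) = alt_sum n (\<lambda>r. fact (card (restr_compl X n))
    * int ((card (restr_compl X n) + r) choose r)
    * (\<Prod>x\<in>restr X n. int r + int (beta X x) - int (beta Y x))) t"
proof (induction n arbitrary: t)
  case 0
  \<comment> \<open>For \<open>n = 0\<close> the sequence is constantly 1, and \<open>1 - x\<close>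
    times the geometric series is 1.\<close>
  have "(\<Sum>r\<le>t. (-1) ^ (t - r) * int (Suc 0 choose (t - r))) = of_bool (t = 0)"
  proof (cases t)
    case (Suc u)
    have "(\<Sum>r\<le>u. (-1) ^ (Suc u - r) * int (Suc 0 choose (Suc u - r))) = (\<Sum>r\<le>u. if r = u then -1 else 0)"
      by (intro sum.cong) (auto simp: Suc_diff_le binomial_eq_0)
    then show ?thesis by (simp add: Suc)
  qed simp
  moreover have "{xs. xs = [] \<and> list_des X Y xs + t = 0} = (if t = 0 then {[]} else {})"
    by auto
  then have "int (defect_count X Y 0 t) = of_bool (t = 0)"
    by (simp add: defect_count_def restr_def del: add_is_0 add_eq_0_iff_both_eq_0)
  ultimately show ?case
    by (simp add: alt_sum_def restr_def restr_compl_def)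
next
  case (Suc n)
  define a where "a n = (\<lambda>r. fact (card (restr_compl X n)) * int ((card (restr_compl X n) + r) choose r)
    * (\<Prod>x\<in>restr X n. int r + int (beta X x) - int (beta Y x)))" for n
  define c where "c = (if Suc n \<in> X then int (beta X (Suc n)) - int (beta Y (Suc n))
      else int (card (restr_compl X n)) + 1)"
  \<comment> \<open>If \<open>Suc n \<in> X\<close>, the product gains the factor
    \<open>r + c\<close>; otherwise the factorial and the binomial absorb it.\<close>
  have "a (Suc n) r = (int r + c) * a n r" for r
  proof (cases "Suc n \<in> X")
    case True
    then have "restr X (Suc n) = insert (Suc n) (restr X n)" "restr_compl X (Suc n) = restr_compl X n"
      by (auto simp: restr_def restr_compl_def le_Suc_eq)
    moreover have "Suc n \<notin> restr X n" "finite (restr X n)" by (auto simp: restr_def)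
    ultimately show ?thesis
      using True by (simp add: a_def c_def algebra_simps)
  next
    case False
    define m where "m = card (restr_compl X n)"
    have "restr X (Suc n) = restr X n" "restr_compl X (Suc n) = insert (Suc n) (restr_compl X n)"
      using False by (auto simp: restr_def restr_compl_def le_Suc_eq)
    moreover have "Suc n \<notin> restr_compl X n" "finite (restr_compl X n)" by (auto simp: restr_compl_def)
    \<comment> \<open>The expression \<open>fact m * ((m + r) choose r)\<close> is
      \<open>(m + r)! / r!\<close>, so raising \<open>m\<close> by one contributes
      \<open>m + r + 1\<close>.\<close>
    moreover have "fact (Suc m) * int ((Suc m + r) choose r) = (int r + int m + 1) * (fact m * int ((m + r) choose r))"
    proof -
      have "Suc m * ((Suc m + r) choose r) = Suc (m + r) * ((m + r) choose r)"
        using Suc_times_binomial_eq[of "m + r" m] binomial_symmetric[of r "m + r"]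
          binomial_symmetric[of r "Suc m + r"] by (simp add: mult.commute)
      then have "int (Suc m * ((Suc m + r) choose r)) = int (Suc (m + r) * ((m + r) choose r))"
        by (rule arg_cong)
      then have "fact m * (int (Suc m) * int ((Suc m + r) choose r))
          = fact m * ((int r + int m + 1) * int ((m + r) choose r))"
        by (simp only: of_nat_mult) (simp add: add_ac)
      then show ?thesis by (simp only: fact_Suc of_nat_mult mult_ac)
    qed
    ultimately show ?thesis
      using False by (simp add: a_def c_def m_def del: fact_Suc)
  qed
  then have step: "alt_sum (Suc n) (a (Suc n)) t = alt_sum (Suc n) (\<lambda>r. (int r + c) * a n r) t"
    by presburger
  have IH: "int (defect_count X Y n t) = alt_sum n (a n) t" for t
    using Suc.IH by (simp add: a_def)
  have "int (defect_count X Y (Suc n) t) = alt_sum (Suc n) (a (Suc n)) t"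
    unfolding step defect_count_Suc c_def[symmetric]
    by (cases t) (simp_all add: IH alt_sum_0 alt_sum_Suc_mult)
  then show ?case by (simp add: a_def)
qed

theorem theorem2p5:
  fixes X Y :: "nat set" and n s :: nat
  assumes "X \<subseteq> {1..}" and "Y \<subseteq> {1..}" and "n \<ge> 1"
  shows "int (perm_count X Y n s) =
    fact (card (restr_compl X n)) *
    (\<Sum>r | r + s \<le> card (restr X n).
       (-1) ^ (card (restr X n) - s - r)
       * int ((card (restr_compl X n) + r) choose r)
       * int ((n + 1) choose (card (restr X n) - s - r))
       * (\<Prod>x\<in>restr X n. int r + int (beta X x) - int (beta Y x)))"
proof (cases "s \<le> card (restr X n)")
  case True
  \<comment> \<open>As \<open>s \<le> card (restr X n)\<close>, the subtraction is exact, and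
    \<open>s\<close> descents mean defect \<open>card (restr X n) - s\<close>.\<close>
  then have "perm_count X Y n s = defect_count X Y n (card (restr X n) - s)"
    unfolding perm_count_eq_list defect_count_def by (intro arg_cong[of _ _ card]) auto
  moreover have "{r. r + s \<le> card (restr X n)} = {..card (restr X n) - s}"
    using True by auto
  ultimately show ?thesis
    by (simp add: defect_count_eq_alt_sum alt_sum_def sum_distrib_left mult_ac del: binomial_Suc_Suc)
next
  case False
  \<comment> \<open>For larger \<open>s\<close> both sides vanish: no word has that many descents,
    and the index set of the sum is empty.\<close>
  have "list_des X Y xs \<le> card (restr X n)" if "xs \<in> permutations_of_set {1..n}" for xs
    using list_des_le[of xs X Y] permutations_of_setD[OF that] by (simp add: restr_def)
  then have "{xs \<in> permutations_of_set {1..n}. list_des X Y xs = s} = {}"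
    using False by auto
  then have "perm_count X Y n s = 0"
    unfolding perm_count_eq_list by simp
  moreover have "{r. r + s \<le> card (restr X n)} = {}"
    using False by auto
  ultimately show ?thesis by simp
qed

end
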